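(* Consider the two-period setting described in the context. Assume: (Irreversible treatment) $D_{i,1}=1\implies D_{i,2}=1$ almost surely. (Exclusion) For each $z\in\{0,1\}$, $Y_{i,t}(0,z)=Y_{i,t}(0)$ and $Y_{i,t}(1,0,z)=Y_{i,t}(1,0)$ for $t\in\{1,2\}$, and $Y_{i,2}(1,1,z)=Y_{i,2}(1,1)$ (that is, potential outcomes do not depend on $z$). (Independence) $\big(Y_{i,1}(0),Y_{i,1}(1,0),Y_{i,2}(0),Y_{i,2}(1,0),Y_{i,2}(1,1),D_{i,1}(1),D_{i,1}(0),D_{i,2}(1),D_{i,2}(0)\big)$ is independent of $Z_i$. (Relevance at $t=1$) $FS_1\neq 0$. (Monotonicity at $t=1$) $\mathbb{P}(F_1)=0$. Suppose there exist $\underline{\Delta},\overline{\Delta}\in\mathbb{R}$ with $\underline{\Delta}\le 0\le\overline{\Delta}$ such that $\underline{\Delta}\le\Delta_2^0(g)\le\overline{\Delta}$ for all $g\in\{(C_1,AT_2),(NT_1,C_2),(NT_1,F_2)\}$ with $\mathbb{P}(g)>0$. Then a lower bound for $\Delta_2^1(C_1)$ is $$L=\frac{RF_2}{FS_1}+\mathbb{P}(D_{i,2}>D_{i,1}\mid Z_i=0)\frac{\underline{\Delta}}{FS_1}-\mathbb{P}(D_{i,2}>D_{i,1}\mid Z_i=1)\frac{\overline{\Delta}}{FS_1}$$ and an upper bound is $$U=\frac{RF_2}{FS_1}+\mathbb{P}(D_{i,2}>D_{i,1}\mid Z_i=0)\frac{\overline{\Delta}}{FS_1}-\mathbb{P}(D_{i,2}>D_{i,1}\mid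 Z_i=1)\frac{\underline{\Delta}}{FS_1};$$ that is, $L\le\Delta_2^1(C_1)\le U$. If, in addition, $\Delta_2^0(g)=\Delta_2^0(g')$ for all $g,g'\in\{(C_1,AT_2),(NT_1,C_2),(NT_1,F_2)\}$ with $\mathbb{P}(g)>0$ and $\mathbb{P}(g')>0$, then $$L^*=\frac{RF_2}{FS_1}+\Big[\mathbf{1}(FS_2\le FS_1)\underline{\Delta}+\mathbf{1}(FS_2>FS_1)\overline{\Delta}\Big]\frac{FS_1-FS_2}{FS_1}$$ is a lower bound for $\Delta_2^1(C_1)$ and $$U^*=\frac{RF_2}{FS_1}+\Big[\mathbf{1}(FS_2\le FS_1)\overline{\Delta}+\mathbf{1}(FS_2>FS_1)\underline{\Delta}\Big]\frac{FS_1-FS_2}{FS_1}$$ is an upper bound, i.e. $L^*\le\Delta_2^1(C_1)\le U^*$, and these bounds are (weakly) tighter than the previous ones: $L\le L^*$ and $U^*\le U$.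
   Context: Setting. Time is $t\in\{1,2\}$; $i$ denotes a generic observation. $Z_i\in\{0,1\}$ is a time-invariant binary instrument with $0<\mathbb{P}(Z_i=1)<1$. $D_{i,t}(z)\in\{0,1\}$ is the potential treatment status at $t$ under instrument value $z$, and the observed status is $D_{i,t}=D_{i,t}(Z_i)$. No unit is treated before period 1. $Y_{i,t}(0,z)$ is the potential outcome at $t$ if $i$ has not been treated up to $t$ and the instrument is $z$; $Y_{i,t}(1,\tau,z)$, $\tau\in\{0,\dots,t-1\}$, is the potential outcome at $t$ if $i$ is first treated at period $t-\tau$ and the instrument is $z$. The observed outcome $Y_{i,t}$ equals $Y_{i,t}(0,Z_i)$ if $i$ has not been treated up to $t$, and $Y_{i,t}(1,t-s,Z_i)$ if $i$ was first treated at $s\le t$. All expectations written are assumed to exist (one may take all potential outcomes to be integrable). Latent types at $t$ (events): $AT_t=\{D_{i,t}(1)=D_{i,t}(0)=1\}$, $C_t=\{D_{i,t}(1)>D_{i,t}(0)\}$, $F_t=\{D_{i,t}(1)<D_{i,t}(0)\}$, $NT_t=\{D_{i,t}(1)=D_{i,t}(0)=0\}$. A pair such as $(C_1,AT_2)$ denotes the intersection $C_1\cap AT_2$. Estimands: $RF_t=\mathbb{E}[Y_{i,t}\mid Z_i=1]-\mathbb{E}[Y_{i,t}\mid Z_i=0]$ and $FS_t=\mathbb{E}[D_{i,t}\mid Z_i=1]-\mathbb{E}[D_{i,t}\mid Z_i=0]$. Causal effects (under exclusion): for a latent group $g$, $\Delta_t^\tau(g)=\mathbb{E}[Y_{i,t}(1,\tau)-Y_{i,t}(0)\mid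 g]$. $\mathbf{1}(\cdot)$ is the indicator function. *)

theory Defs
  imports "HOL-Probability.Probability"
begin

text \<open>
  Periods and instrument values are natural numbers, \<open>t \<in> {1, 2}\<close> and \<open>z \<in> {0, 1}\<close>;
  \<open>D t z\<close> is the potential treatment status, \<open>Y0z t z\<close> stands for $Y_t(0,z)$ and
  \<open>Y1z t \<tau> z\<close> for $Y_t(1,\tau,z)$ with \<open>\<tau> < t\<close>.  Values of these functions at other
  indices are irrelevant.
\<close>

locale iv_panel = prob_space M
  for M :: "'a measure"
    and Z :: "'a \<Rightarrow> nat"
    and D :: "nat \<Rightarrow> nat \<Rightarrow> 'a \<Rightarrow> nat"
    and Y0z :: "nat \<Rightarrow> nat \<Rightarrow> 'a \<Rightarrow> real"
    and Y1z :: "nat \<Rightarrow> nat \<Rightarrow> nat \<Rightarrow> 'a \<Rightarrow> real" +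
  assumes Z_measurable: "Z \<in> M \<rightarrow>\<^sub>M count_space UNIV"
    and Z_binary: "\<And>\<omega>. \<omega> \<in> space M \<Longrightarrow> Z \<omega> \<in> {0, 1}"
    and Z_pos: "0 < \<P>(\<omega> in M. Z \<omega> = 1)"
    and Z_less_1: "\<P>(\<omega> in M. Z \<omega> = 1) < 1"
    and D_measurable: "\<And>t z. t \<in> {1, 2} \<Longrightarrow> z \<in> {0, 1} \<Longrightarrow> D t z \<in> M \<rightarrow>\<^sub>M count_space UNIV"
    and D_binary: "\<And>t z \<omega>. t \<in> {1, 2} \<Longrightarrow> z \<in> {0, 1} \<Longrightarrow> \<omega> \<in> space M \<Longrightarrow> D t z \<omega> \<in> {0, 1}"
    and Y0z_integrable: "\<And>t z. t \<in> {1, 2} \<Longrightarrow> z \<in> {0, 1} \<Longrightarrow> integrable M (Y0z t z)"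
    and Y1z_integrable:
      "\<And>t \<tau> z. t \<in> {1, 2} \<Longrightarrow> \<tau> < t \<Longrightarrow> z \<in> {0, 1} \<Longrightarrow> integrable M (Y1z t \<tau> z)"

definition obs_treatment :: "('a \<Rightarrow> nat) \<Rightarrow> (nat \<Rightarrow> nat \<Rightarrow> 'a \<Rightarrow> nat) \<Rightarrow> nat \<Rightarrow> 'a \<Rightarrow> nat" where
  "obs_treatment Z D t \<omega> = D t (Z \<omega>) \<omega>"

text \<open>Treatment histories start in period 1, as no unit is treated earlier.\<close>

definition first_treated :: "('a \<Rightarrow> nat) \<Rightarrow> (nat \<Rightarrow> nat \<Rightarrow> 'a \<Rightarrow> nat) \<Rightarrow> 'a \<Rightarrow> nat" where
  "first_treated Z D \<omega> = (LEAST s. 1 \<le> s \<and> obs_treatment Z D s \<omega> = 1)"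

definition obs_outcome ::
  "('a \<Rightarrow> nat) \<Rightarrow> (nat \<Rightarrow> nat \<Rightarrow> 'a \<Rightarrow> nat) \<Rightarrow> (nat \<Rightarrow> nat \<Rightarrow> 'a \<Rightarrow> real) \<Rightarrow>
    (nat \<Rightarrow> nat \<Rightarrow> nat \<Rightarrow> 'a \<Rightarrow> real) \<Rightarrow> nat \<Rightarrow> 'a \<Rightarrow> real" where
  "obs_outcome Z D Y0z Y1z t \<omega> =
    (if \<forall>s\<in>{1..t}. obs_treatment Z D s \<omega> = 0 then Y0z t (Z \<omega>) \<omega>
     else Y1z t (t - first_treated Z D \<omega>) (Z \<omega>) \<omega>)"

definition always_takers :: "'a measure \<Rightarrow> (nat \<Rightarrow> nat \<Rightarrow> 'a \<Rightarrow> nat) \<Rightarrow> nat \<Rightarrow> 'a set" where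
  "always_takers M D t = {\<omega> \<in> space M. D t 1 \<omega> = 1 \<and> D t 0 \<omega> = 1}"

definition compliers :: "'a measure \<Rightarrow> (nat \<Rightarrow> nat \<Rightarrow> 'a \<Rightarrow> nat) \<Rightarrow> nat \<Rightarrow> 'a set" where
  "compliers M D t = {\<omega> \<in> space M. D t 1 \<omega> > D t 0 \<omega>}"

definition defiers :: "'a measure \<Rightarrow> (nat \<Rightarrow> nat \<Rightarrow> 'a \<Rightarrow> nat) \<Rightarrow> nat \<Rightarrow> 'a set" where
  "defiers M D t = {\<omega> \<in> space M. D t 1 \<omega> < D t 0 \<omega>}"

definition never_takers :: "'a measure \<Rightarrow> (nat \<Rightarrow> nat \<Rightarrow> 'a \<Rightarrow> nat) \<Rightarrow> nat \<Rightarrow> 'a set" where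
  "never_takers M D t = {\<omega> \<in> space M. D t 1 \<omega> = 0 \<and> D t 0 \<omega> = 0}"

text \<open>Expectation conditional on an event; meaningful only if the event has positive probability.\<close>

definition cond_expect :: "'a measure \<Rightarrow> ('a \<Rightarrow> real) \<Rightarrow> 'a set \<Rightarrow> real" where
  "cond_expect M X A = (LINT \<omega>:A|M. X \<omega>) / measure M A"

definition reduced_form ::
  "'a measure \<Rightarrow> ('a \<Rightarrow> nat) \<Rightarrow> (nat \<Rightarrow> nat \<Rightarrow> 'a \<Rightarrow> nat) \<Rightarrow> (nat \<Rightarrow> nat \<Rightarrow> 'a \<Rightarrow> real) \<Rightarrow>
    (nat \<Rightarrow> nat \<Rightarrow> nat \<Rightarrow> 'a \<Rightarrow> real) \<Rightarrow> nat \<Rightarrow> real" where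
  "reduced_form M Z D Y0z Y1z t =
    cond_expect M (obs_outcome Z D Y0z Y1z t) {\<omega> \<in> space M. Z \<omega> = 1} -
    cond_expect M (obs_outcome Z D Y0z Y1z t) {\<omega> \<in> space M. Z \<omega> = 0}"

definition first_stage ::
  "'a measure \<Rightarrow> ('a \<Rightarrow> nat) \<Rightarrow> (nat \<Rightarrow> nat \<Rightarrow> 'a \<Rightarrow> nat) \<Rightarrow> nat \<Rightarrow> real" where
  "first_stage M Z D t =
    cond_expect M (\<lambda>\<omega>. real (obs_treatment Z D t \<omega>)) {\<omega> \<in> space M. Z \<omega> = 1} -
    cond_expect M (\<lambda>\<omega>. real (obs_treatment Z D t \<omega>)) {\<omega> \<in> space M. Z \<omega> = 0}"

text \<open>\<open>Y0 t\<close> and \<open>Y1 t \<tau>\<close> are the potential outcomes $Y_t(0)$ and $Y_t(1,\tau)$ under exclusion.\<close>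

definition causal_effect ::
  "'a measure \<Rightarrow> (nat \<Rightarrow> 'a \<Rightarrow> real) \<Rightarrow> (nat \<Rightarrow> nat \<Rightarrow> 'a \<Rightarrow> real) \<Rightarrow> nat \<Rightarrow> nat \<Rightarrow> 'a set \<Rightarrow> real" where
  "causal_effect M Y0 Y1 t \<tau> g = cond_expect M (\<lambda>\<omega>. Y1 t \<tau> \<omega> - Y0 t \<omega>) g"

text \<open>
  The library constant \<^const>\<open>prob_space.indep_var\<close> requires both random variables to have the
  same value type; this is the same notion for variables of different types.
\<close>

definition indep_rvs ::
  "'a measure \<Rightarrow> 'b measure \<Rightarrow> ('a \<Rightarrow> 'b) \<Rightarrow> 'c measure \<Rightarrow> ('a \<Rightarrow> 'c) \<Rightarrow> bool" where
  "indep_rvs M S X T Y \<longleftrightarrow>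
    X \<in> M \<rightarrow>\<^sub>M S \<and> Y \<in> M \<rightarrow>\<^sub>M T \<and>
    prob_space.indep_set M
      {X -` A \<inter> space M | A. A \<in> sets S} {Y -` B \<inter> space M | B. B \<in> sets T}"

end

theory Submission
  imports Defs
begin

text \<open>
  Independence turns the reduced form and the first stages into unconditional expectations of
  differences of potential quantities, and irreversibility into a property of both potential
  treatment paths.  Almost surely the difference of the potential observed outcomes at time 2 is
  $Y_2(1,1) - Y_2(0)$ on $C_1$, corrected by $Y_2(1,0) - Y_2(0)$ with sign $-$ on $(C_1,AT_2)$,
  $+$ on $(NT_1,C_2)$ and $-$ on $(NT_1,F_2)$.  Integrating expresses $\Delta_2^1(C_1)\,FS_1 - RF_2$
  through the three nuisance effects weighted by the group probabilities $a$, $b$, $c$.  The bounds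
  follow from $a + c \le P(D_2 > D_1 \mid Z = 0)$, $b \le P(D_2 > D_1 \mid Z = 1)$ and
  $FS_1 - FS_2 = a - b + c$.
\<close>

section \<open>Conditioning on an independent event\<close>

text \<open>\<open>f\<close> need only be measurable for the sigma-algebra pulled back along
  \<open>X\<close>, so later uses need not exhibit \<open>f\<close> as an explicit function of the
  whole vector \<open>X\<close>. The sigma-algebras generated by \<open>f\<close> and by
  \<open>h (Y \<omega>)\<close> lie inside those generated by \<open>X\<close> and \<open>Y\<close>,
  and independence passes to subfamilies.\<close>

lemma indep_rvs_indep_var:
  fixes f :: "'a \<Rightarrow> real" and h :: "'c \<Rightarrow> real"
  assumes "prob_space M" and indep: "indep_rvs M S X T Y"
    and f: "f \<in> borel_measurable (vimage_algebra (space M) X S)"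
    and h: "h \<in> borel_measurable T"
  shows "prob_space.indep_var M borel f borel (\<lambda>\<omega>. h (Y \<omega>))"
proof -
  interpret prob_space M by fact
  have X: "X \<in> M \<rightarrow>\<^sub>M S" and Y: "Y \<in> M \<rightarrow>\<^sub>M T"
    and ind: "indep_set {X -` A \<inter> space M | A. A \<in> sets S} {Y -` B \<inter> space M | B. B \<in> sets T}"
    using indep by (auto simp: indep_rvs_def)
  have XS: "X \<in> space M \<rightarrow> space S" and YT: "Y \<in> space M \<rightarrow> space T"
    using measurable_space[OF X] measurable_space[OF Y] by auto
  let ?V = "vimage_algebra (space M) X S" and ?W = "vimage_algebra (space M) Y T"
  have hY: "(\<lambda>\<omega>. h (Y \<omega>)) \<in> borel_measurable ?W"
    by (rule measurable_compose[OF measurable_vimage_algebra1[OF YT] h])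
  have V_sub: "sets ?V \<subseteq> sets M" and W_sub: "sets ?W \<subseteq> sets M"
    using X Y by (auto simp: sets_vimage_algebra2[OF XS] sets_vimage_algebra2[OF YT])
  have "indep_set (sets ?V) (sets ?W)"
    using ind by (simp add: sets_vimage_algebra2[OF XS] sets_vimage_algebra2[OF YT])
  moreover have "sigma_sets (space M) {f -` A \<inter> space M | A. A \<in> sets borel} \<subseteq> sets ?V"
    using f by (intro sets.sigma_sets_subset[of _ ?V, simplified]) (auto dest: measurable_sets)
  moreover have "sigma_sets (space M) {(\<lambda>\<omega>. h (Y \<omega>)) -` A \<inter> space M | A. A \<in> sets borel} \<subseteq> sets ?W"
    using hY by (intro sets.sigma_sets_subset[of _ ?W, simplified]) (auto dest: measurable_sets)
  ultimately have "indep_set (sigma_sets (space M) {f -` A \<inter> space M | A. A \<in> sets borel})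
      (sigma_sets (space M) {(\<lambda>\<omega>. h (Y \<omega>)) -` A \<inter> space M | A. A \<in> sets borel})"
    unfolding indep_set_def
    by (elim indep_sets_mono_sets) (auto split: bool.split)
  moreover have "random_variable borel f"
    using f V_sub by (auto simp: measurable_def)
  moreover have "random_variable borel (\<lambda>\<omega>. h (Y \<omega>))"
    using measurable_compose[OF Y h] .
  ultimately show ?thesis
    by (simp add: indep_var_eq)
qed

text \<open>The integral of \<open>f\<close> times the indicator of the conditioning event factors
  by independence, and dividing by the probability of that event leaves the plain
  expectation.\<close>

lemma cond_expect_indep:
  fixes f :: "'a \<Rightarrow> real"
  assumes "prob_space M" and indep: "indep_rvs M S X T Y"
    and f: "f \<in> borel_measurable (vimage_algebra (space M) X S)" and int: "integrable M f"
    and B: "B \<in> sets T" and pos: "measure M {\<omega> \<in> space M. Y \<omega> \<in> B} \<noteq> 0"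
  shows "cond_expect M f {\<omega> \<in> space M. Y \<omega> \<in> B} = (LINT \<omega>|M. f \<omega>)"
proof -
  interpret prob_space M by fact
  have Y: "Y \<in> M \<rightarrow>\<^sub>M T"
    using indep by (auto simp: indep_rvs_def)
  let ?A = "{\<omega> \<in> space M. Y \<omega> \<in> B}"
  have A: "?A \<in> events"
    using measurable_sets[OF Y B] by (simp add: vimage_def Int_def conj_commute)
  have ind: "indep_var borel f borel (\<lambda>\<omega>. indicator B (Y \<omega>) :: real)"
    using B by (intro indep_rvs_indep_var[OF assms(1) indep f]) auto
  \<comment> \<open>The two indicators are known to agree only on the space, so each exchange goes
    through a congruence rule for the integral.\<close>
  have eq: "indicator ?A \<omega> = (indicator B (Y \<omega>) :: real)" if "\<omega> \<in> space M" for \<omega>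
    using that by (simp add: indicator_def)
  have "integrable M (indicator ?A :: 'a \<Rightarrow> real)"
    using A by (simp add: less_top[symmetric])
  then have intB: "integrable M (\<lambda>\<omega>. indicator B (Y \<omega>) :: real)"
    by (rule Bochner_Integration.integrable_cong[THEN iffD1, rotated -1]) (auto simp: eq)
  have "(LINT \<omega>:?A|M. f \<omega>) = (LINT \<omega>|M. f \<omega> * indicator B (Y \<omega>))"
    unfolding set_lebesgue_integral_def
    by (rule Bochner_Integration.integral_cong) (auto simp: eq)
  also have "\<dots> = (LINT \<omega>|M. f \<omega>) * (LINT \<omega>|M. indicator B (Y \<omega>))"
    by (rule indep_var_lebesgue_integral[OF ind int intB])
  also have "(LINT \<omega>|M. indicator B (Y \<omega>)) = (LINT \<omega>|M. indicator ?A \<omega> :: real)"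
    by (rule Bochner_Integration.integral_cong) (auto simp: eq)
  also have "\<dots> = measure M ?A"
    using A by simp
  finally show ?thesis
    using pos by (simp add: cond_expect_def)
qed

text \<open>Null events are covered: there both sides are zero, whatever value
  \<open>cond_expect\<close> takes. Latent groups can therefore be handled without splitting on
  their probabilities.\<close>

lemma (in finite_measure) integral_indicator_eq_cond_expect:
  assumes "A \<in> sets M"
  shows "(LINT \<omega>|M. indicator A \<omega> * f \<omega>) = cond_expect M f A * measure M A"
proof (cases "measure M A = 0")
  case True
  then have "A \<in> null_sets M"
    using assms by (auto simp: emeasure_eq_measure)
  then have "AE \<omega> in M. indicator A \<omega> * f \<omega> = 0"
    by (auto dest: AE_not_in simp: indicator_def)
  then show ?thesis
    using True by (simp add: integral_eq_zero_AE)
next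
  case False
  then show ?thesis
    by (simp add: cond_expect_def set_lebesgue_integral_def)
qed

section \<open>Arithmetic of the bounds\<close>

text \<open>Each effect is replaced by the unfavourable endpoint, and then the weights
  \<open>a + c\<close> and \<open>b\<close> are enlarged to \<open>p\<close> and \<open>q\<close>.
  The effects are constrained only at positive weight, matching groups of positive
  probability.\<close>

lemma weighted_effect_bounds:
  fixes a b c :: real
  assumes "0 \<le> a" "0 \<le> b" "0 \<le> c" "lo \<le> 0" "0 \<le> hi" "a + c \<le> p" "b \<le> q"
    and "0 < a \<Longrightarrow> lo \<le> x \<and> x \<le> hi" "0 < b \<Longrightarrow> lo \<le> y \<and> y \<le> hi" "0 < c \<Longrightarrow> lo \<le> z \<and> z \<le> hi"
  shows "p * lo - q * hi \<le> x * a - y * b + z * c" "x * a - y * b + z * c \<le> p * hi - q * lo"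
proof -
  have bnd: "lo * w \<le> v * w \<and> v * w \<le> hi * w" if "0 \<le> w" "0 < w \<Longrightarrow> lo \<le> v \<and> v \<le> hi" for v w
    using that by (cases "w = 0") (auto intro: mult_right_mono)
  \<comment> \<open>The signs of the endpoints enter here: enlarging a weight lowers its product
    with \<open>lo\<close> and raises its product with \<open>hi\<close>.\<close>
  have "lo * p \<le> lo * (a + c)" "hi * (a + c) \<le> hi * p" "hi * b \<le> hi * q" "lo * q \<le> lo * b"
    using assms by (auto intro: mult_left_mono mult_left_mono_neg)
  then show "p * lo - q * hi \<le> x * a - y * b + z * c" "x * a - y * b + z * c \<le> p * hi - q * lo"
    using bnd[of a x] bnd[of b y] bnd[of c z] assms by (auto simp: algebra_simps)
qed

text \<open>The sign of \<open>m\<close> decides which endpoint minimises \<open>d * m\<close>; the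
  indicators select it.\<close>

lemma common_effect_bounds:
  fixes lo hi d m :: real
  assumes "lo \<le> d" "d \<le> hi"
  shows "(of_bool (0 \<le> m) * lo + of_bool (m < 0) * hi) * m \<le> d * m"
    and "d * m \<le> (of_bool (0 \<le> m) * hi + of_bool (m < 0) * lo) * m"
  using assms by (auto simp: of_bool_def intro: mult_right_mono mult_right_mono_neg)

section \<open>The reduced form at time 2\<close>

text \<open>Gathers the assumptions behind the identity for the reduced form; relevance and the
  bounds on the effects enter only in the final theorem.\<close>

locale dynamic_iv = iv_panel M Z D Y0z Y1z
  for M :: "'a measure" and Z D Y0z Y1z +
  fixes Y0 :: "nat \<Rightarrow> 'a \<Rightarrow> real"
    and Y1 :: "nat \<Rightarrow> nat \<Rightarrow> 'a \<Rightarrow> real"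
  assumes irreversible:
      "AE \<omega> in M. obs_treatment Z D 1 \<omega> = 1 \<longrightarrow> obs_treatment Z D 2 \<omega> = 1"
    and exclusion:
      "\<And>t z. t \<in> {1, 2} \<Longrightarrow> z \<in> {0, 1} \<Longrightarrow> AE \<omega> in M. Y0z t z \<omega> = Y0 t \<omega>"
      "\<And>t z. t \<in> {1, 2} \<Longrightarrow> z \<in> {0, 1} \<Longrightarrow> AE \<omega> in M. Y1z t 0 z \<omega> = Y1 t 0 \<omega>"
      "\<And>z. z \<in> {0, 1} \<Longrightarrow> AE \<omega> in M. Y1z 2 1 z \<omega> = Y1 2 1 \<omega>"
    and independence:
      "indep_rvs M
        (borel \<Otimes>\<^sub>M borel \<Otimes>\<^sub>M borel \<Otimes>\<^sub>M borel \<Otimes>\<^sub>M borel \<Otimes>\<^sub>M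
          count_space UNIV \<Otimes>\<^sub>M count_space UNIV \<Otimes>\<^sub>M count_space UNIV \<Otimes>\<^sub>M count_space UNIV)
        (\<lambda>\<omega>. (Y0 1 \<omega>, Y1 1 0 \<omega>, Y0 2 \<omega>, Y1 2 0 \<omega>, Y1 2 1 \<omega>,
          D 1 1 \<omega>, D 1 0 \<omega>, D 2 1 \<omega>, D 2 0 \<omega>))
        (count_space UNIV) Z"
    and monotonicity: "measure M (defiers M D 1) = 0"
begin

text \<open>The sigma-algebra generated by the nine potential quantities. Measurability with respect
  to it is the criterion for being independent of \<open>Z\<close>.\<close>

definition potentials :: "'a measure" where
  "potentials = vimage_algebra (space M)
    (\<lambda>\<omega>. (Y0 1 \<omega>, Y1 1 0 \<omega>, Y0 2 \<omega>, Y1 2 0 \<omega>, Y1 2 1 \<omega>, D 1 1 \<omega>, D 1 0 \<omega>, D 2 1 \<omega>, D 2 0 \<omega>))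
    (borel \<Otimes>\<^sub>M borel \<Otimes>\<^sub>M borel \<Otimes>\<^sub>M borel \<Otimes>\<^sub>M borel \<Otimes>\<^sub>M
      count_space UNIV \<Otimes>\<^sub>M count_space UNIV \<Otimes>\<^sub>M count_space UNIV \<Otimes>\<^sub>M count_space UNIV)"

text \<open>The time-2 outcome that would be observed with the instrument set to \<open>z\<close>,
  under exclusion. Treatment in period 1 takes precedence, as the first treated period fixes the
  exposure length.\<close>

definition outcome2 :: "nat \<Rightarrow> 'a \<Rightarrow> real" where
  "outcome2 z \<omega> =
    (if D 1 z \<omega> = 1 then Y1 2 1 \<omega> else if D 2 z \<omega> = 1 then Y1 2 0 \<omega> else Y0 2 \<omega>)"

section \<open>Measurability and integrability of the potential quantities\<close>

lemma space_potentials [simp]: "space potentials = space M"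
  by (simp add: potentials_def)

lemma potentials_measurable:
  "(\<lambda>\<omega>. (Y0 1 \<omega>, Y1 1 0 \<omega>, Y0 2 \<omega>, Y1 2 0 \<omega>, Y1 2 1 \<omega>, D 1 1 \<omega>, D 1 0 \<omega>, D 2 1 \<omega>, D 2 0 \<omega>))
    \<in> potentials \<rightarrow>\<^sub>M borel \<Otimes>\<^sub>M borel \<Otimes>\<^sub>M borel \<Otimes>\<^sub>M borel \<Otimes>\<^sub>M borel \<Otimes>\<^sub>M
      count_space UNIV \<Otimes>\<^sub>M count_space UNIV \<Otimes>\<^sub>M count_space UNIV \<Otimes>\<^sub>M count_space UNIV"
  unfolding potentials_def by (rule measurable_vimage_algebra1) (simp add: space_pair_measure)

lemma potentials_components:
  shows Y_potentials: "Y0 2 \<in> borel_measurable potentials"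
      "Y1 2 0 \<in> borel_measurable potentials" "Y1 2 1 \<in> borel_measurable potentials"
    and D_1_potentials: "D 1 1 \<in> borel_measurable potentials" "D 1 0 \<in> borel_measurable potentials"
    and D_2_potentials: "D 2 1 \<in> borel_measurable potentials" "D 2 0 \<in> borel_measurable potentials"
proof -
  note borel_eq = measurable_cong_sets[OF refl sets_borel_eq_count_space]
  \<comment> \<open>\<open>Xk\<close> is the tail of the right-nested tuple that starts at its k-th
    component; \<open>X8\<close> is the final pair.\<close>
  note X2 = measurable_compose[OF potentials_measurable measurable_snd, unfolded snd_conv]
  note X3 = measurable_compose[OF X2 measurable_snd, unfolded snd_conv]
  note X4 = measurable_compose[OF X3 measurable_snd, unfolded snd_conv]
  note X5 = measurable_compose[OF X4 measurable_snd, unfolded snd_conv]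
  note X6 = measurable_compose[OF X5 measurable_snd, unfolded snd_conv]
  note X7 = measurable_compose[OF X6 measurable_snd, unfolded snd_conv]
  note X8 = measurable_compose[OF X7 measurable_snd, unfolded snd_conv]
  show "Y0 2 \<in> borel_measurable potentials"
    using measurable_compose[OF X3 measurable_fst, unfolded fst_conv] .
  show "Y1 2 0 \<in> borel_measurable potentials"
    using measurable_compose[OF X4 measurable_fst, unfolded fst_conv] .
  show "Y1 2 1 \<in> borel_measurable potentials"
    using measurable_compose[OF X5 measurable_fst, unfolded fst_conv] .
  show "D 1 1 \<in> borel_measurable potentials"
    using measurable_compose[OF X6 measurable_fst, unfolded fst_conv]
    by (simp only: borel_eq)
  show "D 1 0 \<in> borel_measurable potentials"
    using measurable_compose[OF X7 measurable_fst, unfolded fst_conv]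
    by (simp only: borel_eq)
  show "D 2 1 \<in> borel_measurable potentials"
    using measurable_compose[OF X8 measurable_fst, unfolded fst_conv]
    by (simp only: borel_eq)
  show "D 2 0 \<in> borel_measurable potentials"
    using measurable_compose[OF X8 measurable_snd, unfolded snd_conv]
    by (simp only: borel_eq)
qed

lemma D_potentials:
  assumes "t \<in> {1, 2}" "z \<in> {0, 1}"
  shows "D t z \<in> borel_measurable potentials"
  using assms D_1_potentials D_2_potentials by auto

lemma measurable_potentialsD:
  assumes "f \<in> potentials \<rightarrow>\<^sub>M N"
  shows "f \<in> M \<rightarrow>\<^sub>M N"
proof -
  have "sets potentials \<subseteq> sets M"
    unfolding potentials_def using independence
    by (intro sets_image_in_sets) (simp_all add: indep_rvs_def)
  then show ?thesis
    using assms by (auto simp: measurable_def)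
qed

lemma D_borel:
  assumes "t \<in> {1, 2}" "z \<in> {0, 1}"
  shows "D t z \<in> borel_measurable M"
  using D_potentials[OF assms] by (rule measurable_potentialsD)

lemma outcome2_potentials:
  assumes z: "z \<in> {0, 1}"
  shows "outcome2 z \<in> borel_measurable potentials"
proof -
  note [measurable] = Y_potentials D_potentials[of 1, OF _ z] D_potentials[of 2, OF _ z]
  show ?thesis
    unfolding outcome2_def by measurable
qed

text \<open>Integrability is assumed only for outcomes carrying an instrument argument and is
  transferred along the almost sure equalities of exclusion. The measurability which this transfer
  requires comes from independence.\<close>

lemma integrable_Y:
  "integrable M (Y0 2)" "integrable M (Y1 2 0)" "integrable M (Y1 2 1)"
proof -
  show "integrable M (Y0 2)"
    using Y0z_integrable[of 2 0] exclusion(1)[of 2 0] measurable_potentialsD[OF Y_potentials(1)]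
    by (auto intro: integrable_cong_AE_imp)
  show "integrable M (Y1 2 0)"
    using Y1z_integrable[of 2 0 0] exclusion(2)[of 2 0] measurable_potentialsD[OF Y_potentials(2)]
    by (auto intro: integrable_cong_AE_imp)
  show "integrable M (Y1 2 1)"
    using Y1z_integrable[of 2 1 0] exclusion(3)[of 0] measurable_potentialsD[OF Y_potentials(3)]
    by (auto intro: integrable_cong_AE_imp)
qed

lemma integrable_outcome2:
  assumes "z \<in> {0, 1}"
  shows "integrable M (outcome2 z)"
proof (rule Bochner_Integration.integrable_bound)
  show "integrable M (\<lambda>\<omega>. \<bar>Y0 2 \<omega>\<bar> + \<bar>Y1 2 0 \<omega>\<bar> + \<bar>Y1 2 1 \<omega>\<bar>)"
    using integrable_Y by simp
  show "outcome2 z \<in> borel_measurable M"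
    using assms by (simp add: measurable_potentialsD outcome2_potentials)
qed (auto simp: outcome2_def)

lemma integrable_D:
  assumes "t \<in> {1, 2}" "z \<in> {0, 1}"
  shows "integrable M (\<lambda>\<omega>. real (D t z \<omega>))"
proof (rule integrable_const_bound[where B = 1])
  show "AE \<omega> in M. norm (real (D t z \<omega>)) \<le> 1"
    using D_binary[OF assms] by (intro AE_I2) force
  show "(\<lambda>\<omega>. real (D t z \<omega>)) \<in> borel_measurable M"
    using D_measurable[OF assms] by measurable
qed

section \<open>Removing the conditioning on the instrument\<close>

lemma Z_events: "{\<omega> \<in> space M. Z \<omega> = z} \<in> events"
  using Z_measurable by measurable

lemma prob_Z_nonzero:
  assumes "z \<in> {0, 1}"
  shows "prob {\<omega> \<in> space M. Z \<omega> = z} \<noteq> 0"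
proof -
  have "prob {\<omega> \<in> space M. Z \<omega> = 0} = prob (space M - {\<omega> \<in> space M. Z \<omega> = 1})"
    using Z_binary by (intro arg_cong[where f = prob]) force
  also have "\<dots> = 1 - prob {\<omega> \<in> space M. Z \<omega> = 1}"
    by (rule prob_compl[OF Z_events])
  finally show ?thesis
    using assms Z_pos Z_less_1 by auto
qed

lemma cond_expect_Z:
  assumes "z \<in> {0, 1}" "f \<in> borel_measurable potentials" "integrable M f"
  shows "cond_expect M f {\<omega> \<in> space M. Z \<omega> = z} = expectation f"
  using cond_expect_indep[OF prob_space_axioms independence assms(2)[unfolded potentials_def] assms(3),
      of "{z}"] prob_Z_nonzero[OF assms(1)] by simp

text \<open>This is \<open>cond_expect_Z\<close> applied to an indicator, whose integral over the
  event \<open>Z \<omega> = z\<close> is the numerator of the conditional probability.\<close>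

lemma prob_Z:
  assumes z: "z \<in> {0, 1}" and P: "Measurable.pred potentials P"
  shows "\<P>(\<omega> in M. P \<omega> \<bar> Z \<omega> = z) = \<P>(\<omega> in M. P \<omega>)"
proof -
  have PM: "{\<omega> \<in> space M. P \<omega>} \<in> events"
    using measurable_potentialsD[OF P] by measurable
  have "{\<omega> \<in> space M. P \<omega>} \<in> sets potentials"
    using measurable_sets[OF P, of "{True}"] by (simp add: vimage_def Int_def conj_commute)
  then have "cond_expect M (indicator {\<omega> \<in> space M. P \<omega>}) {\<omega> \<in> space M. Z \<omega> = z} =
      expectation (indicator {\<omega> \<in> space M. P \<omega>})"
    using PM by (intro cond_expect_Z[OF z]) (auto simp: less_top[symmetric])
  moreover have "(LINT \<omega>:{\<omega> \<in> space M. Z \<omega> = z}|M. indicator {\<omega> \<in> space M. P \<omega>} \<omega>) =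
      prob {\<omega> \<in> space M. P \<omega> \<and> Z \<omega> = z}"
  proof -
    have "(LINT \<omega>:{\<omega> \<in> space M. Z \<omega> = z}|M. indicator {\<omega> \<in> space M. P \<omega>} \<omega>) =
        expectation (indicator {\<omega> \<in> space M. P \<omega> \<and> Z \<omega> = z})"
      unfolding set_lebesgue_integral_def
      by (rule Bochner_Integration.integral_cong) (auto simp: indicator_def)
    also have "{\<omega> \<in> space M. P \<omega> \<and> Z \<omega> = z} \<in> events"
      by (rule sets.sets_Collect_conj[OF Z_events PM])
    then have "expectation (indicator {\<omega> \<in> space M. P \<omega> \<and> Z \<omega> = z}) =
      prob {\<omega> \<in> space M. P \<omega> \<and> Z \<omega> = z}" by simp
    finally show ?thesis .
  qed
  ultimately show ?thesis
    using PM by (simp add: cond_prob_def cond_expect_def)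
qed

text \<open>On the event \<open>Z \<omega> = z\<close> the observed outcome is the potential one for
  \<open>z\<close>. Exclusion turns it into \<open>outcome2 z\<close> almost surely, and
  independence drops the conditioning.\<close>

lemma reduced_form_eq:
  "reduced_form M Z D Y0z Y1z 2 = expectation (\<lambda>\<omega>. outcome2 1 \<omega> - outcome2 0 \<omega>)"
proof -
  have "cond_expect M (obs_outcome Z D Y0z Y1z 2) {\<omega> \<in> space M. Z \<omega> = z} = expectation (outcome2 z)"
    if z: "z \<in> {0, 1}" for z
  proof -
    \<comment> \<open>First treatment in period 1 gives exposure 2 - 1 = 1, and first treatment in
      period 2 gives exposure 2 - 2 = 0.\<close>
    have obs: "obs_outcome Z D Y0z Y1z 2 \<omega> =
        (if D 1 (Z \<omega>) \<omega> = 1 then Y1z 2 1 (Z \<omega>) \<omega>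
         else if D 2 (Z \<omega>) \<omega> = 1 then Y1z 2 0 (Z \<omega>) \<omega> else Y0z 2 (Z \<omega>) \<omega>)"
      if "\<omega> \<in> space M" for \<omega>
    proof -
      have bin: "D 1 (Z \<omega>) \<omega> \<in> {0, 1}" "D 2 (Z \<omega>) \<omega> \<in> {0, 1}"
        using D_binary Z_binary that by auto
      have "first_treated Z D \<omega> = 1" if "D 1 (Z \<omega>) \<omega> = 1"
        unfolding first_treated_def
        by (rule Least_equality) (use that in \<open>auto simp: obs_treatment_def\<close>)
      moreover have "first_treated Z D \<omega> = 2" if "D 1 (Z \<omega>) \<omega> \<noteq> 1" "D 2 (Z \<omega>) \<omega> = 1"
        unfolding first_treated_def
        by (rule Least_equality)
          (use that in \<open>auto simp: obs_treatment_def numeral_2_eq_2 not_less_eq_eq[symmetric] le_Suc_eq intro: ccontr\<close>)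
      moreover have "{1..2} = {1, 2::nat}"
        by auto
      ultimately show ?thesis
        using bin by (auto simp: obs_outcome_def obs_treatment_def)
    qed
    \<comment> \<open>The random index \<open>Z \<omega>\<close> is first frozen to
      \<open>z\<close>, because exclusion is stated for each fixed instrument value.\<close>
    have "(LINT \<omega>:{\<omega> \<in> space M. Z \<omega> = z}|M. obs_outcome Z D Y0z Y1z 2 \<omega>) =
        (LINT \<omega>:{\<omega> \<in> space M. Z \<omega> = z}|M. if D 1 z \<omega> = 1 then Y1z 2 1 z \<omega>
         else if D 2 z \<omega> = 1 then Y1z 2 0 z \<omega> else Y0z 2 z \<omega>)"
      using Z_events by (intro set_lebesgue_integral_cong) (auto simp: obs)
    also have "\<dots> = (LINT \<omega>:{\<omega> \<in> space M. Z \<omega> = z}|M. outcome2 z \<omega>)"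
    proof (rule set_lebesgue_integral_cong_AE[OF Z_events])
      have [measurable]: "Y1z 2 1 z \<in> borel_measurable M" "Y1z 2 0 z \<in> borel_measurable M"
          "Y0z 2 z \<in> borel_measurable M"
          "D 1 z \<in> borel_measurable M" "D 2 z \<in> borel_measurable M"
        using z Y1z_integrable Y0z_integrable D_borel by (auto intro: borel_measurable_integrable)
      show "(\<lambda>\<omega>. if D 1 z \<omega> = 1 then Y1z 2 1 z \<omega>
         else if D 2 z \<omega> = 1 then Y1z 2 0 z \<omega> else Y0z 2 z \<omega>) \<in> borel_measurable M"
        by measurable
      show "outcome2 z \<in> borel_measurable M"
        using z by (simp add: measurable_potentialsD outcome2_potentials)
      show "AE \<omega>\<in>{\<omega> \<in> space M. Z \<omega> = z} in M.
          (if D 1 z \<omega> = 1 then Y1z 2 1 z \<omega>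
           else if D 2 z \<omega> = 1 then Y1z 2 0 z \<omega> else Y0z 2 z \<omega>) = outcome2 z \<omega>"
        using exclusion(1)[of 2, OF _ z] exclusion(2)[of 2, OF _ z] exclusion(3)[OF z]
        by (auto simp: outcome2_def)
    qed
    finally show ?thesis
      using cond_expect_Z[OF z outcome2_potentials[OF z] integrable_outcome2[OF z]]
      by (simp add: cond_expect_def)
  qed
  then show ?thesis
    using integrable_outcome2 by (simp add: reduced_form_def)
qed

lemma first_stage_eq:
  assumes t: "t \<in> {1, 2}"
  shows "first_stage M Z D t = expectation (\<lambda>\<omega>. real (D t 1 \<omega>) - real (D t 0 \<omega>))"
proof -
  have "cond_expect M (\<lambda>\<omega>. real (obs_treatment Z D t \<omega>)) {\<omega> \<in> space M. Z \<omega> = z} =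
      expectation (\<lambda>\<omega>. real (D t z \<omega>))" if z: "z \<in> {0, 1}" for z
  proof -
    have "(\<lambda>\<omega>. real (D t z \<omega>)) \<in> borel_measurable potentials"
      using D_potentials[OF t z]
      by (auto simp: measurable_cong_sets[OF refl sets_borel_eq_count_space])
    moreover have "(LINT \<omega>:{\<omega> \<in> space M. Z \<omega> = z}|M. real (obs_treatment Z D t \<omega>)) =
        (LINT \<omega>:{\<omega> \<in> space M. Z \<omega> = z}|M. real (D t z \<omega>))"
      using Z_events by (intro set_lebesgue_integral_cong) (auto simp: obs_treatment_def)
    ultimately show ?thesis
      using cond_expect_Z[OF z _ integrable_D[OF t z]]
      by (simp add: cond_expect_def)
  qed
  then show ?thesis
    using integrable_D[OF t] by (simp add: first_stage_def)
qed

lemma prob_switch_eq: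
  assumes z: "z \<in> {0, 1}"
  shows "\<P>(\<omega> in M. obs_treatment Z D 2 \<omega> > obs_treatment Z D 1 \<omega> \<bar> Z \<omega> = z) =
    \<P>(\<omega> in M. D 2 z \<omega> > D 1 z \<omega>)"
proof -
  have [measurable]: "D 1 z \<in> borel_measurable potentials"
      "D 2 z \<in> borel_measurable potentials"
    using z by (auto intro: D_potentials)
  have "{\<omega> \<in> space M. obs_treatment Z D 2 \<omega> > obs_treatment Z D 1 \<omega> \<and> Z \<omega> = z} =
      {\<omega> \<in> space M. D 2 z \<omega> > D 1 z \<omega> \<and> Z \<omega> = z}"
    by (auto simp: obs_treatment_def)
  then have "\<P>(\<omega> in M. obs_treatment Z D 2 \<omega> > obs_treatment Z D 1 \<omega> \<bar> Z \<omega> = z) =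
      \<P>(\<omega> in M. D 2 z \<omega> > D 1 z \<omega> \<bar> Z \<omega> = z)"
    by (simp add: cond_prob_def)
  also have "\<dots> = \<P>(\<omega> in M. D 2 z \<omega> > D 1 z \<omega>)"
    by (rule prob_Z[OF z]) measurable
  finally show ?thesis .
qed

text \<open>The assumption concerns the observed path, hence the path under \<open>z\<close> only
  where \<open>Z \<omega> = z\<close>. A violation thus has conditional probability zero given that
  event, and by independence unconditional probability zero.\<close>

lemma potential_irreversible:
  assumes z: "z \<in> {0, 1}"
  shows "AE \<omega> in M. D 1 z \<omega> = 1 \<longrightarrow> D 2 z \<omega> = 1"
proof -
  have [measurable]: "D 1 z \<in> borel_measurable potentials"
      "D 2 z \<in> borel_measurable potentials"
    using z by (auto intro: D_potentials)
  have [measurable]: "D 1 z \<in> borel_measurable M" "D 2 z \<in> borel_measurable M"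
    using z by (auto intro: D_borel)
  have ev: "{\<omega> \<in> space M. \<not> (D 1 z \<omega> = 1 \<longrightarrow> D 2 z \<omega> = 1)} \<in> events"
    by measurable
  have "AE \<omega> in M. \<not> (\<not> (D 1 z \<omega> = 1 \<longrightarrow> D 2 z \<omega> = 1) \<and> Z \<omega> = z)"
    using irreversible by eventually_elim (auto simp: obs_treatment_def)
  then have "\<P>(\<omega> in M. \<not> (D 1 z \<omega> = 1 \<longrightarrow> D 2 z \<omega> = 1) \<and> Z \<omega> = z) = 0"
    by (subst prob_eq_0[OF sets.sets_Collect_conj[OF Z_events ev]]) simp
  then have "\<P>(\<omega> in M. \<not> (D 1 z \<omega> = 1 \<longrightarrow> D 2 z \<omega> = 1) \<bar> Z \<omega> = z) = 0"
    by (simp add: cond_prob_def)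
  moreover have "\<P>(\<omega> in M. \<not> (D 1 z \<omega> = 1 \<longrightarrow> D 2 z \<omega> = 1) \<bar> Z \<omega> = z) =
      \<P>(\<omega> in M. \<not> (D 1 z \<omega> = 1 \<longrightarrow> D 2 z \<omega> = 1))"
    by (rule prob_Z[OF z]) measurable
  ultimately have "\<P>(\<omega> in M. \<not> (D 1 z \<omega> = 1 \<longrightarrow> D 2 z \<omega> = 1)) = 0"
    by simp
  then show ?thesis
    using ev by (subst (asm) prob_eq_0) auto
qed

section \<open>Latent types and treatment paths\<close>

lemma type_events:
  assumes t: "t \<in> {1, 2}"
  shows "always_takers M D t \<in> events" "compliers M D t \<in> events"
    and "defiers M D t \<in> events" "never_takers M D t \<in> events"
proof -
  have [measurable]: "D t 0 \<in> borel_measurable M" "D t 1 \<in> borel_measurable M"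
    using t by (auto intro: D_borel)
  show "always_takers M D t \<in> events" "compliers M D t \<in> events"
      "defiers M D t \<in> events" "never_takers M D t \<in> events"
    unfolding always_takers_def compliers_def defiers_def never_takers_def by measurable
qed

abbreviation "C_AT \<equiv> compliers M D 1 \<inter> always_takers M D 2"
abbreviation "NT_C \<equiv> never_takers M D 1 \<inter> compliers M D 2"
abbreviation "NT_F \<equiv> never_takers M D 1 \<inter> defiers M D 2"

text \<open>Of the sixteen binary paths, irreversibility under both instrument values and the
  absence of defiers at time 1 leave seven. The almost sure identities below are then checked path
  by path.\<close>

lemma AE_paths:
  "AE \<omega> in M. (D 1 1 \<omega>, D 1 0 \<omega>, D 2 1 \<omega>, D 2 0 \<omega>) \<in>
    {(1, 1, 1, 1), (1, 0, 1, 0), (1, 0, 1, 1),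
     (0, 0, 0, 0), (0, 0, 1, 0), (0, 0, 0, 1), (0, 0, 1, 1)}"
proof -
  have "AE \<omega> in M. \<omega> \<notin> defiers M D 1"
    using monotonicity type_events(3)[of 1] by (intro AE_not_in) (auto simp: emeasure_eq_measure)
  moreover note potential_irreversible[of 0] potential_irreversible[of 1]
  moreover have "AE \<omega> in M. D 1 0 \<omega> \<in> {0, 1} \<and> D 1 1 \<omega> \<in> {0, 1} \<and> D 2 0 \<omega> \<in> {0, 1} \<and> D 2 1 \<omega> \<in> {0, 1}"
    using D_binary by (intro AE_I2) auto
  ultimately show ?thesis
    using AE_space by (auto simp: defiers_def)
qed

text \<open>Without defiers, the difference of the potential statuses at time 1 is almost surely the
  indicator of the compliers. Relevance therefore says that they have positive probability.\<close>

lemma first_stage_1: "first_stage M Z D 1 = prob (compliers M D 1)"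
proof -
  have "first_stage M Z D 1 = expectation (indicator (compliers M D 1))"
    unfolding first_stage_eq[of 1, OF insertI1]
  proof (rule integral_cong_AE)
    show "AE \<omega> in M. real (D 1 1 \<omega>) - real (D 1 0 \<omega>) = indicator (compliers M D 1) \<omega>"
      using AE_paths AE_space by eventually_elim (auto simp: compliers_def)
  qed (use integrable_D[of 1] type_events[of 1] in \<open>auto intro: borel_measurable_integrable\<close>)
  then show ?thesis
    using type_events(2)[of 1] by simp
qed

text \<open>The change in the instrument's effect on treatment between the periods is 1 on
  \<open>C_AT\<close>, -1 on \<open>NT_C\<close>, 1 on \<open>NT_F\<close>, and 0 on the other
  possible paths.\<close>

lemma first_stage_diff:
  "first_stage M Z D 1 - first_stage M Z D 2 = prob C_AT - prob NT_C + prob NT_F"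
proof -
  have ev: "C_AT \<in> events" "NT_C \<in> events" "NT_F \<in> events"
    using type_events[of 1] type_events[of 2] by auto
  have int: "integrable M (indicator A :: 'a \<Rightarrow> real)" if "A \<in> events" for A
    using that by (simp add: less_top[symmetric])
  have "first_stage M Z D 1 - first_stage M Z D 2 =
      expectation (\<lambda>\<omega>. (real (D 1 1 \<omega>) - real (D 1 0 \<omega>)) - (real (D 2 1 \<omega>) - real (D 2 0 \<omega>)))"
    using integrable_D by (simp add: first_stage_eq)
  also have "\<dots> = expectation (\<lambda>\<omega>. indicator C_AT \<omega> - indicator NT_C \<omega> + indicator NT_F \<omega>)"
  proof (rule integral_cong_AE)
    show "AE \<omega> in M. (real (D 1 1 \<omega>) - real (D 1 0 \<omega>)) - (real (D 2 1 \<omega>) - real (D 2 0 \<omega>)) =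
        indicator C_AT \<omega> - indicator NT_C \<omega> + indicator NT_F \<omega>"
      using AE_paths AE_space
      by eventually_elim
        (auto simp: compliers_def always_takers_def never_takers_def defiers_def indicator_def)
    show "(\<lambda>\<omega>. indicator C_AT \<omega> - indicator NT_C \<omega> + indicator NT_F \<omega> :: real) \<in> borel_measurable M"
      using ev by measurable
  qed (use integrable_D in \<open>auto intro!: borel_measurable_diff borel_measurable_integrable\<close>)
  also have "\<dots> = prob C_AT - prob NT_C + prob NT_F"
    using int[OF ev(1)] int[OF ev(2)] int[OF ev(3)] ev[THEN sets.Int_space_eq2] by simp
  finally show ?thesis .
qed

text \<open>Members of \<open>C_AT\<close> and \<open>NT_F\<close> enter treatment in period 2 under
  \<open>z = 0\<close>, those of \<open>NT_C\<close> under \<open>z = 1\<close>. Only inequalities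
  hold in general, since the path (0, 0, 1, 1) switches under both values.\<close>

lemma prob_switch_bounds:
  "prob C_AT + prob NT_F \<le> \<P>(\<omega> in M. D 2 0 \<omega> > D 1 0 \<omega>)"
  "prob NT_C \<le> \<P>(\<omega> in M. D 2 1 \<omega> > D 1 1 \<omega>)"
proof -
  have ev: "{\<omega> \<in> space M. D 2 z \<omega> > D 1 z \<omega>} \<in> events" if z: "z \<in> {0, 1}" for z
  proof -
    have [measurable]: "D 1 z \<in> borel_measurable M" "D 2 z \<in> borel_measurable M"
      using z by (auto intro: D_borel)
    show ?thesis
      by measurable
  qed
  have C_AT: "C_AT \<in> events" and NT_C: "NT_C \<in> events" and NT_F: "NT_F \<in> events"
    using type_events[of 1] type_events[of 2] by auto
  have "prob C_AT + prob NT_F = prob (C_AT \<union> NT_F)"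
    using C_AT NT_F
    by (intro finite_measure_Union[symmetric]) (auto simp: compliers_def never_takers_def)
  also have "\<dots> \<le> \<P>(\<omega> in M. D 2 0 \<omega> > D 1 0 \<omega>)"
    \<comment> \<open>For a complier, \<open>D 1 1\<close> is at most 1, which forces
      \<open>D 1 0\<close> to be 0; hence \<open>D 2 0 = 1\<close> is a switch.\<close>
    using D_binary[of 1 1]
    by (intro finite_measure_mono ev)
      (fastforce simp: compliers_def never_takers_def always_takers_def defiers_def)+
  finally show "prob C_AT + prob NT_F \<le> \<P>(\<omega> in M. D 2 0 \<omega> > D 1 0 \<omega>)" .
  show "prob NT_C \<le> \<P>(\<omega> in M. D 2 1 \<omega> > D 1 1 \<omega>)"
    by (intro finite_measure_mono ev) (auto simp: compliers_def never_takers_def)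
qed

text \<open>On \<open>C_AT\<close> the instrument changes exposure from 0 to 1, so the exposure-0
  effect is subtracted from the exposure-1 effect. \<open>NT_C\<close> and \<open>NT_F\<close> add
  and subtract an exposure-0 effect, and on paths outside these groups and \<open>C_1\<close> the
  two outcomes coincide. Solving for the effect on \<open>C_1\<close> flips the three signs.\<close>

lemma reduced_form_decomposition:
  "causal_effect M Y0 Y1 2 1 (compliers M D 1) * first_stage M Z D 1 =
    reduced_form M Z D Y0z Y1z 2 +
    (causal_effect M Y0 Y1 2 0 C_AT * prob C_AT - causal_effect M Y0 Y1 2 0 NT_C * prob NT_C +
     causal_effect M Y0 Y1 2 0 NT_F * prob NT_F)"
proof -
  let ?C = "compliers M D 1"
  have ev [measurable]: "?C \<in> events" "C_AT \<in> events" "NT_C \<in> events" "NT_F \<in> events"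
    using type_events[of 1] type_events[of 2] by auto
  have eff [measurable]: "integrable M (\<lambda>\<omega>. Y1 2 1 \<omega> - Y0 2 \<omega>)" "integrable M (\<lambda>\<omega>. Y1 2 0 \<omega> - Y0 2 \<omega>)"
    using integrable_Y by auto
  have int: "integrable M (\<lambda>\<omega>. indicator A \<omega> * f \<omega>)"
    if "A \<in> events" "integrable M f" for A and f :: "'a \<Rightarrow> real"
    using that integrable_mult_indicator[of A M f] by simp
  have "reduced_form M Z D Y0z Y1z 2 = expectation (\<lambda>\<omega>.
      indicator ?C \<omega> * (Y1 2 1 \<omega> - Y0 2 \<omega>) - indicator C_AT \<omega> * (Y1 2 0 \<omega> - Y0 2 \<omega>) +
      indicator NT_C \<omega> * (Y1 2 0 \<omega> - Y0 2 \<omega>) - indicator NT_F \<omega> * (Y1 2 0 \<omega> - Y0 2 \<omega>))"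
    unfolding reduced_form_eq
  proof (rule integral_cong_AE)
    show "AE \<omega> in M. outcome2 1 \<omega> - outcome2 0 \<omega> =
        indicator ?C \<omega> * (Y1 2 1 \<omega> - Y0 2 \<omega>) - indicator C_AT \<omega> * (Y1 2 0 \<omega> - Y0 2 \<omega>) +
        indicator NT_C \<omega> * (Y1 2 0 \<omega> - Y0 2 \<omega>) - indicator NT_F \<omega> * (Y1 2 0 \<omega> - Y0 2 \<omega>)"
      using AE_paths AE_space
      by eventually_elim (auto simp: outcome2_def compliers_def always_takers_def
          never_takers_def defiers_def indicator_def)
    show "(\<lambda>\<omega>. outcome2 1 \<omega> - outcome2 0 \<omega>) \<in> borel_measurable M"
      using integrable_outcome2 by (intro borel_measurable_diff borel_measurable_integrable) auto
  qed (use int ev eff in \<open>intro borel_measurable_integrable Bochner_Integration.integrable_add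
        Bochner_Integration.integrable_diff; simp\<close>)
  also have "\<dots> = expectation (\<lambda>\<omega>. indicator ?C \<omega> * (Y1 2 1 \<omega> - Y0 2 \<omega>)) -
      expectation (\<lambda>\<omega>. indicator C_AT \<omega> * (Y1 2 0 \<omega> - Y0 2 \<omega>)) +
      expectation (\<lambda>\<omega>. indicator NT_C \<omega> * (Y1 2 0 \<omega> - Y0 2 \<omega>)) -
      expectation (\<lambda>\<omega>. indicator NT_F \<omega> * (Y1 2 0 \<omega> - Y0 2 \<omega>))"
    using int[OF ev(1) eff(1)] int[OF ev(2) eff(2)] int[OF ev(3) eff(2)] int[OF ev(4) eff(2)]
    by (simp only: Bochner_Integration.integral_add Bochner_Integration.integral_diff
        Bochner_Integration.integrable_add Bochner_Integration.integrable_diff)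
  finally show ?thesis
    by (simp add: integral_indicator_eq_cond_expect ev causal_effect_def first_stage_1 del: One_nat_def)
qed

end

section \<open>From the decomposition to the two pairs of bounds\<close>

theorem proposition2p3:
  fixes M :: "'a measure"
    and Z :: "'a \<Rightarrow> nat"
    and D :: "nat \<Rightarrow> nat \<Rightarrow> 'a \<Rightarrow> nat"
    and Y0z :: "nat \<Rightarrow> nat \<Rightarrow> 'a \<Rightarrow> real"
    and Y1z :: "nat \<Rightarrow> nat \<Rightarrow> nat \<Rightarrow> 'a \<Rightarrow> real"
    and Y0 :: "nat \<Rightarrow> 'a \<Rightarrow> real"
    and Y1 :: "nat \<Rightarrow> nat \<Rightarrow> 'a \<Rightarrow> real"
    and \<Delta>lo \<Delta>hi :: real
    and groups :: "'a set set"
  assumes setting: "iv_panel M Z D Y0z Y1z"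
    and irreversible:
      "AE \<omega> in M. obs_treatment Z D 1 \<omega> = 1 \<longrightarrow> obs_treatment Z D 2 \<omega> = 1"
    and exclusion:
      "\<And>t z. t \<in> {1, 2} \<Longrightarrow> z \<in> {0, 1} \<Longrightarrow> AE \<omega> in M. Y0z t z \<omega> = Y0 t \<omega>"
      "\<And>t z. t \<in> {1, 2} \<Longrightarrow> z \<in> {0, 1} \<Longrightarrow> AE \<omega> in M. Y1z t 0 z \<omega> = Y1 t 0 \<omega>"
      "\<And>z. z \<in> {0, 1} \<Longrightarrow> AE \<omega> in M. Y1z 2 1 z \<omega> = Y1 2 1 \<omega>"
    and independence:
      "indep_rvs M
        (borel \<Otimes>\<^sub>M borel \<Otimes>\<^sub>M borel \<Otimes>\<^sub>M borel \<Otimes>\<^sub>M borel \<Otimes>\<^sub>M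
          count_space UNIV \<Otimes>\<^sub>M count_space UNIV \<Otimes>\<^sub>M count_space UNIV \<Otimes>\<^sub>M count_space UNIV)
        (\<lambda>\<omega>. (Y0 1 \<omega>, Y1 1 0 \<omega>, Y0 2 \<omega>, Y1 2 0 \<omega>, Y1 2 1 \<omega>,
          D 1 1 \<omega>, D 1 0 \<omega>, D 2 1 \<omega>, D 2 0 \<omega>))
        (count_space UNIV) Z"
    and relevance: "first_stage M Z D 1 \<noteq> 0"
    and monotonicity: "measure M (defiers M D 1) = 0"
    and groups: "groups =
      {compliers M D 1 \<inter> always_takers M D 2,
       never_takers M D 1 \<inter> compliers M D 2,
       never_takers M D 1 \<inter> defiers M D 2}"
    and sign: "\<Delta>lo \<le> 0" "0 \<le> \<Delta>hi"
    and bounds: "\<And>g. g \<in> groups \<Longrightarrow> measure M g > 0 \<Longrightarrow>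
      \<Delta>lo \<le> causal_effect M Y0 Y1 2 0 g \<and> causal_effect M Y0 Y1 2 0 g \<le> \<Delta>hi"
  shows
    "let RF2 = reduced_form M Z D Y0z Y1z 2;
         FS1 = first_stage M Z D 1;
         FS2 = first_stage M Z D 2;
         p0 = \<P>(\<omega> in M. obs_treatment Z D 2 \<omega> > obs_treatment Z D 1 \<omega> \<bar> Z \<omega> = 0);
         p1 = \<P>(\<omega> in M. obs_treatment Z D 2 \<omega> > obs_treatment Z D 1 \<omega> \<bar> Z \<omega> = 1);
         L = RF2 / FS1 + p0 * (\<Delta>lo / FS1) - p1 * (\<Delta>hi / FS1);
         U = RF2 / FS1 + p0 * (\<Delta>hi / FS1) - p1 * (\<Delta>lo / FS1);
         L' = RF2 / FS1 +
           (of_bool (FS2 \<le> FS1) * \<Delta>lo + of_bool (FS2 > FS1) * \<Delta>hi) * ((FS1 - FS2) / FS1);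
         U' = RF2 / FS1 +
           (of_bool (FS2 \<le> FS1) * \<Delta>hi + of_bool (FS2 > FS1) * \<Delta>lo) * ((FS1 - FS2) / FS1);
         \<Delta> = causal_effect M Y0 Y1 2 1 (compliers M D 1)
     in (L \<le> \<Delta> \<and> \<Delta> \<le> U) \<and>
        ((\<forall>g\<in>groups. \<forall>g'\<in>groups. measure M g > 0 \<longrightarrow> measure M g' > 0 \<longrightarrow>
            causal_effect M Y0 Y1 2 0 g = causal_effect M Y0 Y1 2 0 g') \<longrightarrow>
          (L' \<le> \<Delta> \<and> \<Delta> \<le> U') \<and> L \<le> L' \<and> U' \<le> U)"
proof -
  interpret dynamic_iv M Z D Y0z Y1z Y0 Y1
    using setting irreversible exclusion independence monotonicity
    by (simp add: dynamic_iv_def dynamic_iv_axioms_def)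
  define RF FS1 FS2 where defs: "RF = reduced_form M Z D Y0z Y1z 2"
    "FS1 = first_stage M Z D 1" "FS2 = first_stage M Z D 2"
  define p0 p1 where p: "p0 = \<P>(\<omega> in M. D 2 0 \<omega> > D 1 0 \<omega>)" "p1 = \<P>(\<omega> in M. D 2 1 \<omega> > D 1 1 \<omega>)"
  define a b c where abc: "a = prob C_AT" "b = prob NT_C" "c = prob NT_F"
  define x y z where xyz: "x = causal_effect M Y0 Y1 2 0 C_AT"
    "y = causal_effect M Y0 Y1 2 0 NT_C" "z = causal_effect M Y0 Y1 2 0 NT_F"
  define \<Delta> where "\<Delta> = causal_effect M Y0 Y1 2 1 (compliers M D 1)"
  \<comment> \<open>Being a probability, a nonzero \<open>FS1\<close> is positive, so dividing by it
    preserves inequalities.\<close>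
  have FS1: "0 < FS1"
    using relevance unfolding defs first_stage_1 by (simp add: zero_less_measure_iff)
  have nonneg: "0 \<le> a" "0 \<le> b" "0 \<le> c"
    by (simp_all add: abc)
  have sw: "a + c \<le> p0" "b \<le> p1"
    using prob_switch_bounds by (simp_all add: abc p)
  have bnd: "0 < a \<Longrightarrow> \<Delta>lo \<le> x \<and> x \<le> \<Delta>hi" "0 < b \<Longrightarrow> \<Delta>lo \<le> y \<and> y \<le> \<Delta>hi"
      "0 < c \<Longrightarrow> \<Delta>lo \<le> z \<and> z \<le> \<Delta>hi"
    unfolding abc xyz by (intro bounds; simp add: groups)+
  have eff: "\<Delta> = RF / FS1 + (x * a - y * b + z * c) / FS1"
    using reduced_form_decomposition FS1 by (simp add: \<Delta>_def defs abc xyz field_simps)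
  have diff: "FS1 - FS2 = a - b + c"
    using first_stage_diff by (simp add: defs abc)
  \<comment> \<open>\<open>m\<close> is the net weight of the three effects; it equals
    \<open>FS1 - FS2\<close>, so its sign governs the indicators in the tighter bounds.\<close>
  define m where "m = a - b + c"
  have FS_le: "FS2 \<le> FS1 \<longleftrightarrow> 0 \<le> m" "FS2 > FS1 \<longleftrightarrow> m < 0"
    using diff by (auto simp: m_def)
  define l u where lu: "l = (of_bool (0 \<le> m) * \<Delta>lo + of_bool (m < 0) * \<Delta>hi) * m"
    "u = (of_bool (0 \<le> m) * \<Delta>hi + of_bool (m < 0) * \<Delta>lo) * m"
  have LU: "p0 * \<Delta>lo - p1 * \<Delta>hi \<le> x * a - y * b + z * c"
      "x * a - y * b + z * c \<le> p0 * \<Delta>hi - p1 * \<Delta>lo"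
    using weighted_effect_bounds[OF nonneg sign sw bnd] by auto
  \<comment> \<open>The tighter bounds are weighted effects as well, with all three effects equal to an endpoint.\<close>
  have *: "p0 * \<Delta>lo - p1 * \<Delta>hi \<le> d * m \<and> d * m \<le> p0 * \<Delta>hi - p1 * \<Delta>lo"
    if "\<Delta>lo \<le> d" "d \<le> \<Delta>hi" for d
    using weighted_effect_bounds[OF nonneg sign sw, of d d d] that
    by (simp add: m_def algebra_simps)
  have tight: "p0 * \<Delta>lo - p1 * \<Delta>hi \<le> l" "u \<le> p0 * \<Delta>hi - p1 * \<Delta>lo"
    using *[of \<Delta>lo] *[of \<Delta>hi] sign by (auto simp: lu of_bool_def)
  have common: "l \<le> x * a - y * b + z * c \<and> x * a - y * b + z * c \<le> u"
    if eq: "\<forall>g\<in>groups. \<forall>g'\<in>groups. prob g > 0 \<longrightarrow> prob g' > 0 \<longrightarrow>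
        causal_effect M Y0 Y1 2 0 g = causal_effect M Y0 Y1 2 0 g'"
  proof -
    \<comment> \<open>\<open>d\<close> is the effect of any group with positive probability. If all
      three are null, 0 serves, since it lies between the endpoints.\<close>
    obtain d where d: "\<Delta>lo \<le> d" "d \<le> \<Delta>hi"
      and "0 < a \<Longrightarrow> x = d" "0 < b \<Longrightarrow> y = d" "0 < c \<Longrightarrow> z = d"
    proof -
      have "0 < a \<Longrightarrow> 0 < b \<Longrightarrow> x = y" "0 < a \<Longrightarrow> 0 < c \<Longrightarrow> x = z" "0 < b \<Longrightarrow> 0 < c \<Longrightarrow> y = z"
        using eq unfolding groups abc xyz by blast+
      then show ?thesis
        using that[of x] that[of y] that[of z] that[of 0] bnd sign by metis
    qed
    \<comment> \<open>A null group may have a different effect, but its weight is then zero.\<close>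
    then have "x * a = d * a" "y * b = d * b" "z * c = d * c"
      using nonneg by (auto simp: order.order_iff_strict)
    then have "x * a - y * b + z * c = d * m"
      by (simp only: m_def distrib_left right_diff_distrib)
    then show ?thesis
      using common_effect_bounds[OF d] by (simp add: lu)
  qed
  have scale: "RF / FS1 + p / FS1 \<le> RF / FS1 + q / FS1" if "p \<le> q" for p q
    using that FS1 by (simp add: divide_right_mono)
  \<comment> \<open>Each bound becomes \<open>RF / FS1\<close> plus one fraction over
    \<open>FS1\<close>, so all six inequalities follow from \<open>scale\<close> by comparing
    numerators.\<close>
  have rewr: "RF / FS1 + p0 * (v / FS1) - p1 * (w / FS1) = RF / FS1 + (p0 * v - p1 * w) / FS1"
      "k * (m / FS1) = k * m / FS1" for v w k
    by (simp_all add: diff_divide_distrib)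
  have sw_eq: "\<P>(\<omega> in M. obs_treatment Z D 2 \<omega> > obs_treatment Z D 1 \<omega> \<bar> Z \<omega> = 0) = p0"
      "\<P>(\<omega> in M. obs_treatment Z D 2 \<omega> > obs_treatment Z D 1 \<omega> \<bar> Z \<omega> = 1) = p1"
    unfolding p by (rule prob_switch_eq; simp)+
  show ?thesis
    unfolding Let_def sw_eq defs[symmetric] \<Delta>_def[symmetric] FS_le diff[folded m_def]
      rewr lu[symmetric] eff
    by (intro conjI impI scale LU tight common[THEN conjunct1] common[THEN conjunct2])
qed

end
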